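(* Let $n\ge 1$, $p\ge 2$, $S\ge 1$ be integers with $3S\le p$, let $\sigma>0$, and let $X\in\mathbf{R}^{n\times p}$ be a fixed matrix whose columns have unit Euclidean norm and which satisfies $\delta_{2S}+\theta_{S,2S}<1$. Let $\beta\in\mathbf{R}^p$ be any $S$-sparse vector and let $y=X\beta+z$ with $z\sim N(0,\sigma^2 I_n)$. Choose $\lambda_p=\sqrt{2\log p}$. Then, with large probability, the Dantzig selector $\hat\beta$ with parameter $\lambda_p$ obeys $$\|\hat\beta-\beta\|_{\ell_2}^2\le C_1^2\cdot(2\log p)\cdot S\cdot\sigma^2,\qquad C_1=\frac{4}{1-\delta_S-\theta_{S,2S}}.$$ Hence, for small values of $\delta_S+\theta_{S,2S}$, $C_1\approx 4$. For concreteness, if for $a\ge 0$ one chooses $\lambda_p:=\sqrt{2(1+a)\log p}$, then the bound, with $\lambda_p^2$ substituted for $2\log p$, that is, $$\|\hat\beta-\beta\|_{\ell_2}^2\le C_1^2\cdot\lambda_p^2\cdot S\cdot\sigma^2,$$ holds with probability exceeding $1-\left(\sqrt{\pi\log p}\cdot p^{a}\right)^{-1}$.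
   Context: A vector is $S$-sparse if at most $S$ of its entries are nonzero. For $T\subset\{1,\dots,p\}$, $X_T$ is the $n\times|T|$ submatrix of $X$ formed by the columns indexed by $T$. The $S$-restricted isometry constant $\delta_S$ of $X$ is the smallest number such that $(1-\delta_S)\|c\|_{\ell_2}^2\le\|X_Tc\|_{\ell_2}^2\le(1+\delta_S)\|c\|_{\ell_2}^2$ for all $T$ with $|T|\le S$ and all $c\in\mathbf{R}^T$. For $S+S'\le p$, the restricted orthogonality constant $\theta_{S,S'}$ of $X$ is the smallest number such that $|\langle X_Tc,X_{T'}c'\rangle|\le\theta_{S,S'}\|c\|_{\ell_2}\|c'\|_{\ell_2}$ for all disjoint $T,T'\subseteq\{1,\dots,p\}$ with $|T|\le S$, $|T'|\le S'$ and all coefficient vectors $c\in\mathbf{R}^T$, $c'\in\mathbf{R}^{T'}$. The Dantzig selector with parameter $\lambda_p>0$ is a solution $\hat\beta$ of $$\min_{\tilde\beta\in\mathbf{R}^p}\|\tilde\beta\|_{\ell_1}\quad\text{subject to}\quad\|X^*(y-X\tilde\beta)\|_{\ell_\infty}\le\lambda_p\cdot\sigma,$$ where $X^*$ is the transpose of $X$. *)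

theory Defs
  imports "HOL-Probability.Probability"
begin

definition sparse_vec :: "nat \<Rightarrow> real ^ 'p \<Rightarrow> bool" where
  "sparse_vec S b \<longleftrightarrow> card {j. b $ j \<noteq> 0} \<le> S"

text \<open>The product \<open>X\<^sub>T c\<close>. A coefficient vector indexed by \<open>T\<close> is a function on all
  column indices of which only the values on \<open>T\<close> are used; its Euclidean norm is
  \<^term>\<open>L2_set c T\<close>.\<close>

definition submatrix_mult :: "real ^ 'p ^ 'n \<Rightarrow> 'p set \<Rightarrow> ('p \<Rightarrow> real) \<Rightarrow> real ^ 'n" where
  "submatrix_mult X T c = (\<Sum>j\<in>T. c j *\<^sub>R column j X)"

text \<open>Both least elements below exist when \<open>S \<ge> 1\<close>, respectively when \<open>S, S' \<ge> 1\<close> and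
  \<open>S + S'\<close> is at most the number of columns; outside that range the constants are unspecified.\<close>

definition restricted_isometry_const :: "real ^ 'p ^ 'n \<Rightarrow> nat \<Rightarrow> real" where
  "restricted_isometry_const X S =
     (LEAST \<delta>. \<forall>T c. card T \<le> S \<longrightarrow>
        (1 - \<delta>) * (L2_set c T)\<^sup>2 \<le> (norm (submatrix_mult X T c))\<^sup>2 \<and>
        (norm (submatrix_mult X T c))\<^sup>2 \<le> (1 + \<delta>) * (L2_set c T)\<^sup>2)"

definition restricted_orthogonality_const :: "real ^ 'p ^ 'n \<Rightarrow> nat \<Rightarrow> nat \<Rightarrow> real" where
  "restricted_orthogonality_const X S S' =
     (LEAST \<theta>. \<forall>T T' c c'. T \<inter> T' = {} \<longrightarrow> card T \<le> S \<longrightarrow> card T' \<le> S' \<longrightarrow>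
        \<bar>submatrix_mult X T c \<bullet> submatrix_mult X T' c'\<bar> \<le> \<theta> * L2_set c T * L2_set c' T')"

definition l1_norm :: "real ^ 'p \<Rightarrow> real" where
  "l1_norm b = (\<Sum>j\<in>UNIV. \<bar>b $ j\<bar>)"

text \<open>Minimisers need not be unique, so this is a predicate on candidate solutions.\<close>

definition dantzig_selector ::
    "real ^ 'p ^ 'n \<Rightarrow> real ^ 'n \<Rightarrow> real \<Rightarrow> real \<Rightarrow> real ^ 'p \<Rightarrow> bool" where
  "dantzig_selector X y lam \<sigma> =
     is_arg_min l1_norm (\<lambda>b. infnorm (transpose X *v (y - X *v b)) \<le> lam * \<sigma>)"

text \<open>\<open>z \<sim> N(0, \<sigma>\<^sup>2 I)\<close>: the coordinates are independent and each is \<open>N(0, \<sigma>\<^sup>2)\<close>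
  (the second parameter of \<^const>\<open>normal_density\<close> is the standard deviation).\<close>

definition white_noise :: "'a measure \<Rightarrow> real \<Rightarrow> ('a \<Rightarrow> real ^ 'n) \<Rightarrow> bool" where
  "white_noise M \<sigma> z \<longleftrightarrow>
     prob_space.indep_vars M (\<lambda>_. borel) (\<lambda>i \<omega>. z \<omega> $ i) UNIV \<and>
     (\<forall>i. distributed M lborel (\<lambda>\<omega>. z \<omega> $ i) (normal_density 0 \<sigma>))"

text \<open>The constant \<open>C\<^sub>1\<close> as a function of \<open>\<delta>\<^sub>S\<close> and \<open>\<theta>\<^bsub>S,2S\<^esub>\<close>.\<close>

definition dantzig_const :: "real \<Rightarrow> real \<Rightarrow> real" where
  "dantzig_const \<delta> \<theta> = 4 / (1 - \<delta> - \<theta>)"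

end

(* Let h be the error of the selector and T0 the S largest entries of h in absolute value. The l1
   constraint gives |h off T0|_1 <= |h on T0|_1 =: a, and every entry of h off T0 is at most a/S.
   A linear functional on vectors with these two bounds is at most a/S times the sum of its S
   largest coefficients, so the inner product of X h_{T0} with X (h - h_{T0}) is at most
   theta_{S,S} |h_{T0}|_2^2: only delta_S, theta_{S,S} <= theta_{S,2S} enter, and
   |h|_2^2 <= 2 |h_{T0}|_2^2 <= 8 lam^2 S sigma^2 / (1 - delta_S - theta_{S,2S})^2 whenever the noise
   correlations <X_j, z> are all at most lam sigma. The probability of the latter follows from the
   union bound and the Gaussian tail estimate P(N > t) < phi(t)/t. *)
theory Submission
  imports Defs
begin

section \<open>Selecting the largest entries and bounding linear functionals by them\<close>

lemma ex_largest_subset: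
  fixes f :: "'a \<Rightarrow> 'b :: linorder"
  assumes "finite A" "k \<le> card A"
  shows "\<exists>B\<subseteq>A. card B = k \<and> (\<forall>x\<in>B. \<forall>y\<in>A - B. f y \<le> f x)"
  using assms(2)
proof (induction k)
  case 0
  then show ?case by (intro exI[of _ "{}"]) auto
next
  case (Suc k)
  then obtain B where B: "B \<subseteq> A" "card B = k" "\<forall>x\<in>B. \<forall>y\<in>A - B. f y \<le> f x"
    by auto
  have fin: "finite B" using B(1) assms(1) finite_subset by blast
  have ne: "A - B \<noteq> {}" using B Suc.prems by auto
  have "finite (f ` (A - B))" using assms(1) by simp
  then have "Max (f ` (A - B)) \<in> f ` (A - B)" using ne by (intro Max_in) auto
  then obtain m where m: "m \<in> A - B" "f m = Max (f ` (A - B))" by auto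
  have "f y \<le> f m" if "y \<in> A - B" for y
    using that assms(1) m(2) by simp
  then show ?case
    using m(1) B fin by (intro exI[of _ "insert m B"]) auto
qed

text \<open>A mass-moving argument. Off \<open>B\<close> the coefficients are at most the minimum
  \<open>t\<close> of \<open>f\<close> on \<open>B\<close>, and the mass of \<open>u\<close> there
  is at most the room \<open>\<alpha> - u x\<close> left on \<open>B\<close>, where coefficients are
  at least \<open>t\<close>. Filling that room raises the sum to
  \<open>\<alpha> * sum f B\<close>.\<close>

lemma sum_mult_le_largest:
  fixes f u :: "'a \<Rightarrow> real"
  assumes "finite A" "B \<subseteq> A" "B \<noteq> {}"
    and top: "\<And>x y. x \<in> B \<Longrightarrow> y \<in> A - B \<Longrightarrow> f y \<le> f x"
    and f: "\<And>x. x \<in> A \<Longrightarrow> 0 \<le> f x"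
    and u: "\<And>x. x \<in> A \<Longrightarrow> 0 \<le> u x" "\<And>x. x \<in> B \<Longrightarrow> u x \<le> \<alpha>"
    and sum_u: "sum u A \<le> real (card B) * \<alpha>"
  shows "(\<Sum>x\<in>A. f x * u x) \<le> \<alpha> * sum f B"
proof -
  have finB: "finite B" using assms finite_subset by blast
  define t where "t = Min (f ` B)"
  have "t \<in> f ` B" unfolding t_def using finB assms(3) by (intro Min_in) auto
  then obtain m where m: "m \<in> B" "t = f m" by auto
  have tB: "t \<le> f x" if "x \<in> B" for x using that finB by (simp add: t_def)
  have t0: "0 \<le> t" using m f assms(2) by auto
  have split: "sum v A = sum v B + sum v (A - B)" for v :: "'a \<Rightarrow> real"
    using sum.subset_diff[OF assms(2,1), of v] by simp
  have "(\<Sum>x\<in>A - B. f x * u x) \<le> (\<Sum>x\<in>A - B. t * u x)"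
    using top[OF m(1)] m(2) u(1) by (intro sum_mono mult_right_mono) auto
  also have "\<dots> = t * (sum u A - sum u B)" by (simp add: split sum_distrib_left)
  also have "\<dots> \<le> t * (real (card B) * \<alpha> - sum u B)"
    using sum_u t0 by (intro mult_left_mono) auto
  also have "\<dots> = (\<Sum>x\<in>B. t * (\<alpha> - u x))"
    by (simp add: sum_distrib_left[symmetric] sum_subtractf)
  also have "\<dots> \<le> (\<Sum>x\<in>B. f x * (\<alpha> - u x))"
    using tB u(2) by (intro sum_mono mult_right_mono) auto
  also have "\<dots> = \<alpha> * sum f B - (\<Sum>x\<in>B. f x * u x)"
    by (simp add: right_diff_distrib sum_subtractf sum_distrib_left mult.commute)
  finally show ?thesis by (simp add: split)
qed

section \<open>The restricted constants as attained minima\<close>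

text \<open>\<open>Least\<close> on the reals says nothing until a minimum is known to exist. For a
  nonempty closed set bounded below the infimum belongs to the set, hence is that minimum.\<close>

lemma Least_real_closed:
  fixes P :: "real \<Rightarrow> bool"
  assumes "closed {x. P x}" "P b" "\<And>x. P x \<Longrightarrow> a \<le> x"
  shows "P (Least P)" and "P x \<Longrightarrow> Least P \<le> x"
proof -
  have bdd: "bdd_below {x. P x}" using assms(3) by (intro bdd_belowI[of _ a]) auto
  have "Inf {x. P x} \<in> {x. P x}"
    using assms bdd by (intro closed_contains_Inf) auto
  moreover have le: "Inf {x. P x} \<le> x" if "P x" for x
    using that bdd by (intro cInf_lower) auto
  ultimately have "Least P = Inf {x. P x}" by (intro Least_equality) auto
  then show "P (Least P)" "P x \<Longrightarrow> Least P \<le> x"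
    using le \<open>Inf {x. P x} \<in> {x. P x}\<close> by auto
qed

lemma sum_abs_le_sqrt_card_L2_set:
  "(\<Sum>j\<in>T. \<bar>c j\<bar>) \<le> sqrt (real (card T)) * L2_set c T"
  using L2_set_mult_ineq[of c "\<lambda>_. 1" T] by (simp add: L2_set_def mult.commute)

text \<open>Triangle inequality over unit columns, then Cauchy-Schwarz. The crude factor suffices,
  since it only has to show that some constant is admissible in each of the two definitions.\<close>

lemma norm_submatrix_mult_le:
  fixes X :: "real ^ 'p ^ 'n"
  assumes "\<And>j. norm (column j X) = 1"
  shows "norm (submatrix_mult X T c) \<le> sqrt (real CARD('p)) * L2_set c T"
proof -
  have "norm (submatrix_mult X T c) \<le> (\<Sum>j\<in>T. \<bar>c j\<bar>)"
    unfolding submatrix_mult_def by (rule order_trans[OF norm_sum]) (simp add: assms)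
  also have "\<dots> \<le> sqrt (real (card T)) * L2_set c T"
    by (rule sum_abs_le_sqrt_card_L2_set)
  also have "\<dots> \<le> sqrt (real CARD('p)) * L2_set c T"
    by (intro mult_right_mono) (auto simp: L2_set_nonneg card_mono)
  finally show ?thesis .
qed

context
  fixes X :: "real ^ 'p ^ 'n" and S :: nat
  assumes unit: "\<And>j. norm (column j X) = 1" and S: "1 \<le> S"
begin

lemma restricted_isometry_const_Least:
  defines "P \<equiv> \<lambda>\<delta>. \<forall>T c. card T \<le> S \<longrightarrow>
        (1 - \<delta>) * (L2_set c T)\<^sup>2 \<le> (norm (submatrix_mult X T c))\<^sup>2 \<and>
        (norm (submatrix_mult X T c))\<^sup>2 \<le> (1 + \<delta>) * (L2_set c T)\<^sup>2"
  shows "P (restricted_isometry_const X S)"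
    and "P \<delta> \<Longrightarrow> restricted_isometry_const X S \<le> \<delta>"
proof -
  have 1: "closed {x. P x}"
    unfolding P_def
    by (intro closed_Collect_all closed_Collect_imp closed_Collect_conj closed_Collect_le
        open_Collect_const continuous_intros)
  have 2: "P (real CARD('p))"
    unfolding P_def
  proof (intro allI impI conjI)
    fix T :: "'p set" and c :: "'p \<Rightarrow> real"
    have "(1 - real CARD('p)) * (L2_set c T)\<^sup>2 \<le> 0"
      by (intro mult_nonpos_nonneg) (auto simp: Suc_leI)
    also have "0 \<le> (norm (submatrix_mult X T c))\<^sup>2" by simp
    finally show "(1 - real CARD('p)) * (L2_set c T)\<^sup>2 \<le> (norm (submatrix_mult X T c))\<^sup>2" .
    have "(norm (submatrix_mult X T c))\<^sup>2 \<le> (sqrt (real CARD('p)) * L2_set c T)\<^sup>2"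
      by (intro power_mono norm_submatrix_mult_le unit) auto
    also have "\<dots> = real CARD('p) * (L2_set c T)\<^sup>2"
      by (simp add: power_mult_distrib)
    also have "\<dots> \<le> (1 + real CARD('p)) * (L2_set c T)\<^sup>2"
      by (intro mult_right_mono) auto
    finally show "(norm (submatrix_mult X T c))\<^sup>2 \<le> (1 + real CARD('p)) * (L2_set c T)\<^sup>2" .
  qed
  \<comment> \<open>A single unit column with coefficient 1 has both norms equal to 1, and the upper
    inequality becomes \<open>1 \<le> 1 + x\<close>.\<close>
  have 3: "0 \<le> x" if "P x" for x
    using that S unit unfolding P_def
    by (auto dest!: spec[of _ "{undefined}"] spec[of _ "\<lambda>_. 1"] simp: submatrix_mult_def)
  have eq: "restricted_isometry_const X S = Least P"
    by (simp add: restricted_isometry_const_def P_def)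
  show "P (restricted_isometry_const X S)" "P \<delta> \<Longrightarrow> restricted_isometry_const X S \<le> \<delta>"
    unfolding eq using Least_real_closed[OF 1 2 3] by auto
qed

text \<open>Two distinct columns provide disjoint singletons, which force admissible constants to be
  nonnegative. With a single column one of the two sets would always be empty, every real would be
  admissible, and no least one would exist.\<close>

lemma restricted_orthogonality_const_nonneg_bound:
  assumes "1 \<le> S'" "2 \<le> CARD('p)"
  shows "0 \<le> restricted_orthogonality_const X S S'" (is ?A)
    and "T \<inter> T' = {} \<Longrightarrow> card T \<le> S \<Longrightarrow> card T' \<le> S' \<Longrightarrow>
      \<bar>submatrix_mult X T c \<bullet> submatrix_mult X T' c'\<bar>
        \<le> restricted_orthogonality_const X S S' * L2_set c T * L2_set c' T'"
proof -
  define P where "P = (\<lambda>\<theta>. \<forall>T T' c c'. T \<inter> T' = {} \<longrightarrow> card T \<le> S \<longrightarrow> card T' \<le> S' \<longrightarrow>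
        \<bar>submatrix_mult X T c \<bullet> submatrix_mult X T' c'\<bar> \<le> \<theta> * L2_set c T * L2_set c' T')"
  have 1: "closed {x. P x}"
    unfolding P_def
    by (intro closed_Collect_all closed_Collect_imp closed_Collect_conj closed_Collect_le
        open_Collect_const continuous_intros)
  have 2: "P (real CARD('p))"
    unfolding P_def
  proof (intro allI impI conjI)
    fix T T' :: "'p set" and c c' :: "'p \<Rightarrow> real"
    have "\<bar>submatrix_mult X T c \<bullet> submatrix_mult X T' c'\<bar>
        \<le> norm (submatrix_mult X T c) * norm (submatrix_mult X T' c')"
      by (rule Cauchy_Schwarz_ineq2)
    also have "\<dots> \<le> (sqrt (real CARD('p)) * L2_set c T) * (sqrt (real CARD('p)) * L2_set c' T')"
      by (intro mult_mono norm_submatrix_mult_le unit) (auto simp: L2_set_nonneg)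
    also have "\<dots> = real CARD('p) * L2_set c T * L2_set c' T'"
      by simp
    finally show "\<bar>submatrix_mult X T c \<bullet> submatrix_mult X T' c'\<bar>
        \<le> real CARD('p) * L2_set c T * L2_set c' T'" .
  qed
  have 3: "0 \<le> x" if "P x" for x
  proof -
    obtain i j :: 'p where "i \<noteq> j"
      using assms(2) card_2_iff' by (metis card_le_Suc0_iff_eq finite not_less_eq_eq numeral_2_eq_2 UNIV_I)
    then have "\<bar>submatrix_mult X {i} (\<lambda>_. 1) \<bullet> submatrix_mult X {j} (\<lambda>_. 1)\<bar>
        \<le> x * L2_set (\<lambda>_. 1) {i} * L2_set (\<lambda>_. 1) {j}"
      using that S assms(1) unfolding P_def
      by (elim allE[of _ "{i}"] allE[of _ "{j}"] allE[of _ "\<lambda>_. 1"]) auto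
    then show ?thesis by simp
  qed
  have eq: "restricted_orthogonality_const X S S' = Least P"
    by (simp add: restricted_orthogonality_const_def P_def)
  have P: "P (restricted_orthogonality_const X S S')"
    unfolding eq using Least_real_closed[OF 1 2 3] by auto
  then show ?A by (rule 3)
  show "\<bar>submatrix_mult X T c \<bullet> submatrix_mult X T' c'\<bar>
        \<le> restricted_orthogonality_const X S S' * L2_set c T * L2_set c' T'"
    if "T \<inter> T' = {}" "card T \<le> S" "card T' \<le> S'"
    using P that unfolding P_def by blast
qed

end

text \<open>The constant for \<open>S'\<close> satisfies the inequalities for the smaller family of
  sets, so minimality applies. This turns the assumption on \<delta>_{2S} into one on
  \<delta>_S.\<close>

lemma restricted_isometry_const_mono:
  fixes X :: "real ^ 'p ^ 'n"
  assumes "\<And>j. norm (column j X) = 1" "1 \<le> S" "S \<le> S'"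
  shows "restricted_isometry_const X S \<le> restricted_isometry_const X S'"
proof (rule restricted_isometry_const_Least(2)[OF assms(1,2)])
  have "1 \<le> S'" using assms by simp
  from restricted_isometry_const_Least(1)[OF assms(1) this]
  show "\<forall>T c. card T \<le> S \<longrightarrow>
      (1 - restricted_isometry_const X S') * (L2_set c T)\<^sup>2 \<le> (norm (submatrix_mult X T c))\<^sup>2 \<and>
      (norm (submatrix_mult X T c))\<^sup>2 \<le> (1 + restricted_isometry_const X S') * (L2_set c T)\<^sup>2"
    using order_trans[OF _ \<open>S \<le> S'\<close>] by blast
qed

section \<open>The deterministic bound for vectors in the cone\<close>

lemma matrix_vector_mult_eq_submatrix_mult:
  fixes X :: "real ^ 'p ^ 'n"
  shows "X *v h = submatrix_mult X UNIV (($) h)"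
  by (simp add: submatrix_mult_def matrix_mult_sum scalar_mult_eq_scaleR)

lemma inner_submatrix_mult:
  "w \<bullet> submatrix_mult X T c = (\<Sum>j\<in>T. c j * (w \<bullet> column j X))"
  by (simp add: submatrix_mult_def inner_sum_right)

text \<open>The inner product of \<open>w\<close> (the image of the part of \<open>h\<close> on
  \<open>T0\<close>) with \<open>X *v h\<close> is at least
  \<open>(1 - \<delta> - \<theta>) * L\<^sup>2\<close> by \<open>RIP\<close> and \<open>ROC\<close>,
  and at most \<open>\<tau> * sqrt (real S) * L\<close> by \<open>corr\<close>. This bounds
  \<open>L\<close>, and the part of \<open>h\<close> off \<open>T0\<close> has no larger Euclidean
  norm than \<open>L\<close>. In the application \<open>T\<close> is the support of the true
  vector.\<close>

lemma norm_sq_le_of_cone: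
  fixes X :: "real ^ 'p ^ 'n" and h :: "real ^ 'p"
  assumes S: "1 \<le> S" "2 * S \<le> CARD('p)"
    and RIP: "\<And>T c. card T \<le> S \<Longrightarrow>
        (1 - \<delta>) * (L2_set c T)\<^sup>2 \<le> (norm (submatrix_mult X T c))\<^sup>2"
    and ROC: "\<And>T T' c c'. T \<inter> T' = {} \<Longrightarrow> card T \<le> S \<Longrightarrow> card T' \<le> S \<Longrightarrow>
        \<bar>submatrix_mult X T c \<bullet> submatrix_mult X T' c'\<bar> \<le> \<theta> * L2_set c T * L2_set c' T'"
    and "0 \<le> \<theta>" "\<delta> + \<theta> < 1"
    and T: "card T \<le> S" and cone: "(\<Sum>j\<in>-T. \<bar>h $ j\<bar>) \<le> (\<Sum>j\<in>T. \<bar>h $ j\<bar>)"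
    and corr: "\<And>j. \<bar>(X *v h) \<bullet> column j X\<bar> \<le> \<tau>"
  shows "(norm h)\<^sup>2 \<le> 2 * real S * (\<tau> / (1 - \<delta> - \<theta>))\<^sup>2"
proof -
  obtain T0 where T0: "card T0 = S"
      "\<And>x y. x \<in> T0 \<Longrightarrow> y \<in> UNIV - T0 \<Longrightarrow> \<bar>h $ y\<bar> \<le> \<bar>h $ x\<bar>"
    using ex_largest_subset[of "UNIV :: 'p set" S "\<lambda>j. \<bar>h $ j\<bar>"] S by auto
  have ne: "T0 \<noteq> {}" using T0(1) S(1) by auto
  define a where "a = (\<Sum>j\<in>T0. \<bar>h $ j\<bar>)"
  define L where "L = L2_set (($) h) T0"
  define w where "w = submatrix_mult X T0 (($) h)"
  have L0: "0 \<le> L" by (simp add: L_def)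
  have a0: "0 \<le> a" by (simp add: a_def sum_nonneg)
  have \<tau>0: "0 \<le> \<tau>" using corr[of undefined] by linarith
  have aL: "a \<le> sqrt (real S) * L"
    using sum_abs_le_sqrt_card_L2_set[of "($) h" T0] by (simp add: a_def L_def T0)
  have compl: "(\<Sum>j\<in>-A. f j) = (\<Sum>j\<in>UNIV. f j) - (\<Sum>j\<in>A. f j)" for A and f :: "'p \<Rightarrow> real"
    using sum.subset_diff[of A UNIV f] by (simp add: Compl_eq_Diff_UNIV)
  \<comment> \<open>With the indicator of \<open>T\<close> as weight and cap 1, the mass is
    \<open>card T \<le> S\<close>. So the cone condition passes from \<open>T\<close> to
    \<open>T0\<close>: the sum grows inside and shrinks outside.\<close>
  have "(\<Sum>j\<in>UNIV. \<bar>h $ j\<bar> * of_bool (j \<in> T)) \<le> 1 * (\<Sum>j\<in>T0. \<bar>h $ j\<bar>)"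
    using T0 ne T by (intro sum_mult_le_largest) auto
  then have "(\<Sum>j\<in>T. \<bar>h $ j\<bar>) \<le> a" by (simp add: a_def)
  then have tail: "(\<Sum>j\<in>-T0. \<bar>h $ j\<bar>) \<le> a"
    using cone by (simp add: compl a_def)
  \<comment> \<open>An entry off \<open>T0\<close> is below each of the \<open>S\<close> entries on
    \<open>T0\<close>, hence below their average.\<close>
  have small: "\<bar>h $ j\<bar> \<le> a / real S" if "j \<in> -T0" for j
  proof -
    have "real (card T0) * \<bar>h $ j\<bar> \<le> a"
      unfolding a_def using T0(2) that by (intro sum_bounded_below) auto
    then show ?thesis using S(1) T0(1) by (simp add: field_simps)
  qed
  have "S \<le> card (-T0)"
    using S(2) T0(1) by (simp add: Compl_eq_Diff_UNIV card_Diff_subset)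
  \<comment> \<open>\<open>T1\<close> ranks columns by their correlation with \<open>w\<close>, not
    by the entries of \<open>h\<close>; this lets one block of size \<open>S\<close> control the
    whole cross term.\<close>
  then obtain T1 where T1: "T1 \<subseteq> -T0" "card T1 = S"
      "\<And>x y. x \<in> T1 \<Longrightarrow> y \<in> -T0 - T1 \<Longrightarrow> \<bar>w \<bullet> column y X\<bar> \<le> \<bar>w \<bullet> column x X\<bar>"
    using ex_largest_subset[of "-T0" S "\<lambda>j. \<bar>w \<bullet> column j X\<bar>"] by auto
  have T1ne: "T1 \<noteq> {}" using T1(2) S(1) by auto
  \<comment> \<open>Signs as coefficients turn the sum of absolute correlations into an inner
    product to which \<open>ROC\<close> applies; their Euclidean norm is at most
    \<open>sqrt (real S)\<close>.\<close>
  have "(\<Sum>j\<in>T1. \<bar>w \<bullet> column j X\<bar>) = w \<bullet> submatrix_mult X T1 (\<lambda>j. sgn (w \<bullet> column j X))"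
    by (simp add: inner_submatrix_mult abs_sgn mult.commute)
  also have "\<dots> \<le> \<theta> * L * L2_set (\<lambda>j. sgn (w \<bullet> column j X)) T1"
    unfolding L_def w_def by (rule order_trans[OF abs_ge_self ROC]) (use T0 T1 in auto)
  also have "\<dots> \<le> \<theta> * L * sqrt (real S)"
  proof (intro mult_left_mono)
    have "(\<Sum>j\<in>T1. (sgn (w \<bullet> column j X))\<^sup>2) \<le> real (card T1) * 1"
      by (intro sum_bounded_above) (simp add: sgn_if)
    then show "L2_set (\<lambda>j. sgn (w \<bullet> column j X)) T1 \<le> sqrt (real S)"
      by (simp add: L2_set_def T1)
  qed (use \<open>0 \<le> \<theta>\<close> L0 in auto)
  finally have top: "(\<Sum>j\<in>T1. \<bar>w \<bullet> column j X\<bar>) \<le> \<theta> * L * sqrt (real S)" .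
  define v where "v = submatrix_mult X (-T0) (($) h)"
  have Xh: "X *v h = w + v"
    unfolding matrix_vector_mult_eq_submatrix_mult w_def v_def submatrix_mult_def
    using sum.subset_diff[of T0 UNIV "\<lambda>j. h $ j *\<^sub>R column j X"]
    by (simp add: Compl_eq_Diff_UNIV add.commute)
  have "\<bar>w \<bullet> v\<bar> \<le> (\<Sum>j\<in>-T0. \<bar>w \<bullet> column j X\<bar> * \<bar>h $ j\<bar>)"
    unfolding v_def inner_submatrix_mult
    by (rule order_trans[OF sum_abs]) (simp add: abs_mult mult.commute)
  \<comment> \<open>The weights \<open>\<bar>h $ j\<bar>\<close> have cap \<open>a / real S\<close>
    by \<open>small\<close> and total mass at most \<open>a = real S * (a / real S)\<close> by
    \<open>tail\<close>.\<close>
  also have "\<dots> \<le> a / real S * (\<Sum>j\<in>T1. \<bar>w \<bullet> column j X\<bar>)"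
    using T1 T1ne small tail S(1) by (intro sum_mult_le_largest) auto
  also have "\<dots> \<le> (sqrt (real S) * L) / real S * (\<theta> * L * sqrt (real S))"
    using aL top a0 L0 by (intro mult_mono divide_right_mono sum_nonneg) auto
  also have "\<dots> = \<theta> * L\<^sup>2 * ((sqrt (real S))\<^sup>2 / real S)"
    by (simp add: power2_eq_square del: real_sqrt_mult_self)
  also have "\<dots> = \<theta> * L\<^sup>2" using S(1) by simp
  finally have cross: "\<bar>w \<bullet> v\<bar> \<le> \<theta> * L\<^sup>2" .
  have "w \<bullet> (X *v h) = (\<Sum>j\<in>T0. h $ j * ((X *v h) \<bullet> column j X))"
    unfolding inner_commute[of w] by (simp add: w_def inner_submatrix_mult)
  also have "\<dots> \<le> (\<Sum>j\<in>T0. \<bar>h $ j\<bar> * \<tau>)"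
  proof (intro sum_mono)
    fix j
    have "h $ j * ((X *v h) \<bullet> column j X) \<le> \<bar>h $ j\<bar> * \<bar>(X *v h) \<bullet> column j X\<bar>"
      unfolding abs_mult[symmetric] by (rule abs_ge_self)
    also have "\<dots> \<le> \<bar>h $ j\<bar> * \<tau>" by (intro mult_left_mono corr) simp
    finally show "h $ j * ((X *v h) \<bullet> column j X) \<le> \<bar>h $ j\<bar> * \<tau>" .
  qed
  also have "\<dots> = \<tau> * a" by (simp add: a_def sum_distrib_left mult.commute)
  also have "\<dots> \<le> \<tau> * (sqrt (real S) * L)" by (intro mult_left_mono aL \<tau>0)
  finally have "w \<bullet> (X *v h) \<le> \<tau> * sqrt (real S) * L" by simp
  moreover have "(1 - \<delta>) * L\<^sup>2 \<le> w \<bullet> w"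
    using RIP[of T0 "($) h"] T0(1) by (simp add: L_def w_def power2_norm_eq_inner)
  ultimately have "(1 - \<delta> - \<theta>) * L * L \<le> \<tau> * sqrt (real S) * L"
    using cross unfolding Xh by (simp add: inner_add_right algebra_simps power2_eq_square)
  \<comment> \<open>Cancelling \<open>L\<close> requires \<open>L \<noteq> 0\<close>; for
    \<open>L = 0\<close> the claim is nonnegativity of the right side.\<close>
  then have "(1 - \<delta> - \<theta>) * L \<le> \<tau> * sqrt (real S)"
    using L0 \<tau>0 by (cases "L = 0") auto
  then have "L \<le> \<tau> * sqrt (real S) / (1 - \<delta> - \<theta>)"
    using \<open>\<delta> + \<theta> < 1\<close> by (simp add: field_simps)
  then have L2: "L\<^sup>2 \<le> (\<tau> * sqrt (real S) / (1 - \<delta> - \<theta>))\<^sup>2" using L0 by (intro power_mono)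
  \<comment> \<open>One factor of each square is bounded by the cap and the other is summed by
    \<open>tail\<close>, giving \<open>a\<^sup>2 / real S \<le> L\<^sup>2\<close>.\<close>
  have "(\<Sum>j\<in>-T0. (h $ j)\<^sup>2) \<le> (\<Sum>j\<in>-T0. a / real S * \<bar>h $ j\<bar>)"
  proof (intro sum_mono)
    fix j assume "j \<in> -T0"
    from mult_right_mono[OF small[OF this] abs_ge_zero[of "h $ j"]]
    show "(h $ j)\<^sup>2 \<le> a / real S * \<bar>h $ j\<bar>" by (simp add: power2_eq_square)
  qed
  also have "\<dots> = a / real S * (\<Sum>j\<in>-T0. \<bar>h $ j\<bar>)" by (simp add: sum_distrib_left)
  also have "\<dots> \<le> a / real S * a" using a0 tail by (intro mult_left_mono) auto
  also have "\<dots> = a\<^sup>2 / real S" by (simp add: power2_eq_square)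
  also have "\<dots> \<le> (sqrt (real S) * L)\<^sup>2 / real S"
    using aL a0 by (intro divide_right_mono power_mono) auto
  also have "\<dots> = L\<^sup>2" using S(1) by (simp add: power_mult_distrib)
  finally have "(\<Sum>j\<in>-T0. (h $ j)\<^sup>2) \<le> L\<^sup>2" .
  moreover have "(norm h)\<^sup>2 = L\<^sup>2 + (\<Sum>j\<in>-T0. (h $ j)\<^sup>2)"
    by (simp add: compl L_def L2_set_def norm_vec_def sum_nonneg)
  ultimately have "(norm h)\<^sup>2 \<le> 2 * L\<^sup>2" by simp
  also have "\<dots> \<le> 2 * (\<tau> * sqrt (real S) / (1 - \<delta> - \<theta>))\<^sup>2" using L2 by simp
  also have "\<dots> = 2 * real S * (\<tau> / (1 - \<delta> - \<theta>))\<^sup>2"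
    by (simp add: power_mult_distrib power_divide)
  finally show ?thesis .
qed

section \<open>Gaussian tails and the noise correlations\<close>

lemma has_real_derivative_std_normal_density:
  "(std_normal_density has_real_derivative - x * std_normal_density x) (at x)"
proof -
  have "((\<lambda>x. exp (- x\<^sup>2 / 2)) has_real_derivative exp (- x\<^sup>2 / 2) * - x) (at x)"
    by (auto intro!: derivative_eq_intros)
  from DERIV_cmult[OF this, of "1 / sqrt (2 * pi)"] show ?thesis
    by (simp add: std_normal_density_def[abs_def] mult_ac)
qed

lemma std_normal_density_at_top: "(std_normal_density \<longlongrightarrow> 0) at_top"
proof -
  have "((\<lambda>x::real. exp (- (x\<^sup>2 / 2))) \<longlongrightarrow> 0) at_top"
    by (rule filterlim_compose[OF exp_at_bot filterlim_compose[OF filterlim_uminus_at_bot_at_top]])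
      (auto intro!: filterlim_tendsto_pos_mult_at_top[OF tendsto_const, of "1/2", simplified]
        filterlim_pow_at_top filterlim_ident)
  from tendsto_mult_right_zero[OF this, of "1 / sqrt (2 * pi)"] show ?thesis
    by (simp add: std_normal_density_def[abs_def])
qed

context prob_space
begin

text \<open>On \<open>{t..}\<close> the factor \<open>x / t\<close> is at least 1, and inserting it
  into the tail integral gives an integrand with antiderivative
  \<open>- (std_normal_density x / t)\<close>.\<close>

lemma std_normal_tail_less:
  assumes Y: "distributed M lborel Y std_normal_density" and t: "0 < t"
  shows "prob {\<omega> \<in> space M. t \<le> Y \<omega>} < std_normal_density t / t"
proof -
  let ?f = "\<lambda>x. std_normal_density x * indicator {t..} x"
  let ?g = "\<lambda>x. (x / t) * std_normal_density x * indicator {t..} x"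
  have "(\<integral>\<^sup>+x. ennreal ((x / t) * std_normal_density x) * indicator {t..} x \<partial>lborel)
      = ennreal (0 - - (std_normal_density t / t))"
  proof (rule nn_integral_FTC_atLeast[where F = "\<lambda>x. - (std_normal_density x / t)"])
    show "((\<lambda>x. - (std_normal_density x / t)) \<longlongrightarrow> 0) at_top"
      using tendsto_minus[OF tendsto_divide_zero[OF std_normal_density_at_top, of t]] by simp
    show "((\<lambda>x. - (std_normal_density x / t)) has_real_derivative
        (x / t) * std_normal_density x) (at x)" for x
      using DERIV_minus[OF DERIV_cdivide[OF has_real_derivative_std_normal_density[of x], where c = t]]
      by simp
  qed (use t in \<open>auto intro!: mult_nonneg_nonneg\<close>)
  then have g: "has_bochner_integral lborel ?g (std_normal_density t / t)"
    using t by (intro has_bochner_integral_nn_integral)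
      (auto simp: ennreal_mult'' ennreal_indicator nn_integral_set_ennreal intro!: AE_I2 split: split_indicator)
  have f_int: "integrable lborel ?f"
    using integrable_mult_indicator[of "{t..}" lborel std_normal_density]
    by (simp add: integrable_normal_density mult.commute)
  have "emeasure M {\<omega> \<in> space M. t \<le> Y \<omega>} = emeasure M (Y -` {t..} \<inter> space M)"
    by (intro arg_cong[where f = "emeasure M"]) auto
  also have "\<dots> = (\<integral>\<^sup>+x. ennreal (std_normal_density x) * indicator {t..} x \<partial>lborel)"
    by (intro distributed_emeasure[OF Y]) auto
  also have "\<dots> = (\<integral>\<^sup>+x. ennreal (?f x) \<partial>lborel)"
    by (intro nn_integral_cong) (auto split: split_indicator)
  also have "\<dots> = ennreal (integral\<^sup>L lborel ?f)"
    using f_int by (intro nn_integral_eq_integral) auto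
  finally have prob: "prob {\<omega> \<in> space M. t \<le> Y \<omega>} = integral\<^sup>L lborel ?f"
    by (simp add: measure_def integral_nonneg)
  have le: "?f x \<le> ?g x" for x
    using t by (auto split: split_indicator simp: field_simps intro!: mult_right_mono)
  have int: "integrable lborel (\<lambda>x. ?g x - ?f x)"
    using g f_int by (auto simp: has_bochner_integral_iff)
  \<comment> \<open>Strictness: a nonnegative function with integral zero vanishes almost
    everywhere, but this difference is positive on an interval of length 1.\<close>
  have "integral\<^sup>L lborel (\<lambda>x. ?g x - ?f x) \<noteq> 0"
  proof
    assume "integral\<^sup>L lborel (\<lambda>x. ?g x - ?f x) = 0"
    then have "AE x in lborel. ?g x - ?f x = 0"
      using integral_nonneg_eq_0_iff_AE[OF int] le by auto
    then have "AE x in lborel. x \<notin> {t<..<t + 1}"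
    proof eventually_elim
      case (elim x)
      show ?case
      proof
        assume "x \<in> {t<..<t + 1}"
        then have "(x / t - 1) * std_normal_density x = 0"
          using elim by (simp add: algebra_simps)
        then show False using \<open>x \<in> {t<..<t + 1}\<close> t normal_density_pos[of 1 0 x] by auto
      qed
    qed
    then have "emeasure lborel {t<..<t + 1} = 0"
      by (subst (asm) AE_iff_measurable[where N = "{t<..<t + 1}"]) auto
    then show False by simp
  qed
  moreover have "0 \<le> integral\<^sup>L lborel (\<lambda>x. ?g x - ?f x)"
    using le by (intro integral_nonneg_AE) auto
  moreover have "integral\<^sup>L lborel (\<lambda>x. ?g x - ?f x) = std_normal_density t / t - integral\<^sup>L lborel ?f"
    using g f_int by (simp add: has_bochner_integral_iff)
  ultimately show ?thesis unfolding prob by linarith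
qed

text \<open>A union bound over both one-sided tails of every \<open>Y j\<close>, using that
  \<open>- Y j\<close> is again standard normal. Only the marginal laws enter, as correlations with
  different columns are in general dependent.\<close>

lemma prob_all_abs_std_normal_le:
  fixes Y :: "'i::finite \<Rightarrow> 'a \<Rightarrow> real"
  assumes Y: "\<And>j. distributed M lborel (Y j) std_normal_density" and t: "0 < t"
  shows "1 - 2 * real CARD('i) * std_normal_density t / t
    < prob {\<omega> \<in> space M. \<forall>j. \<bar>Y j \<omega>\<bar> \<le> t}"
proof -
  have [measurable]: "random_variable borel (Y j)" for j
    using distributed_measurable[OF Y[of j]] by simp
  have Y': "distributed M lborel (\<lambda>\<omega>. - Y j \<omega>) std_normal_density" for j
    using normal_density_affine[OF Y[of j], of "-1" 0] by simp
  let ?P = "\<lambda>j. {\<omega> \<in> space M. t \<le> Y j \<omega>}"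
  let ?N = "\<lambda>j. {\<omega> \<in> space M. t \<le> - Y j \<omega>}"
  have "1 - prob {\<omega> \<in> space M. \<forall>j. \<bar>Y j \<omega>\<bar> \<le> t} = prob (space M - {\<omega> \<in> space M. \<forall>j. \<bar>Y j \<omega>\<bar> \<le> t})"
    by (subst prob_compl) auto
  also have "\<dots> \<le> prob (\<Union>j. ?P j \<union> ?N j)"
  proof (intro finite_measure_mono subsetI)
    fix \<omega> assume "\<omega> \<in> space M - {\<omega> \<in> space M. \<forall>j. \<bar>Y j \<omega>\<bar> \<le> t}"
    then obtain j where "\<omega> \<in> space M" "\<not> \<bar>Y j \<omega>\<bar> \<le> t" by auto
    then have "\<omega> \<in> ?P j \<union> ?N j" by (auto simp: abs_if split: if_splits)
    then show "\<omega> \<in> (\<Union>j. ?P j \<union> ?N j)" by blast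
  qed auto
  also have "\<dots> \<le> (\<Sum>j\<in>UNIV. prob (?P j \<union> ?N j))"
    by (intro finite_measure_subadditive_finite) auto
  also have "\<dots> \<le> (\<Sum>j\<in>UNIV. prob (?P j) + prob (?N j))"
    by (intro sum_mono measure_Un_le) auto
  also have "\<dots> < (\<Sum>j\<in>(UNIV :: 'i set). std_normal_density t / t + std_normal_density t / t)"
    using std_normal_tail_less[OF Y t] std_normal_tail_less[OF Y' t]
    by (intro sum_strict_mono add_strict_mono) auto
  finally show ?thesis by simp
qed

text \<open>The scaled inner product is a sum of independent centred Gaussians with variances
  \<open>(u $ i)\<^sup>2\<close>, which add up to 1.\<close>

lemma white_noise_inner_distributed:
  assumes noise: "white_noise M \<sigma> z" and "0 < \<sigma>" and u: "norm u = 1"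
  shows "distributed M lborel (\<lambda>\<omega>. (u \<bullet> z \<omega>) / \<sigma>) std_normal_density"
proof -
  \<comment> \<open>Zero coordinates would contribute degenerate Gaussians without a density, so the
    sum runs over the support of \<open>u\<close>.\<close>
  define I where "I = {i. u $ i \<noteq> 0}"
  have norm_u: "(\<Sum>i\<in>I. (u $ i)\<^sup>2) = 1"
  proof -
    have "(\<Sum>i\<in>I. (u $ i)\<^sup>2) = (\<Sum>i\<in>UNIV. (u $ i)\<^sup>2)"
      by (intro sum.mono_neutral_left) (auto simp: I_def)
    also have "\<dots> = (norm u)\<^sup>2" by (simp add: norm_vec_def L2_set_def sum_nonneg)
    finally show ?thesis using u by simp
  qed
  have "indep_vars (\<lambda>_. borel) (\<lambda>i \<omega>. 0 + (u $ i / \<sigma>) * z \<omega> $ i) I"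
    using noise unfolding white_noise_def
    by (intro indep_vars_compose2[where M' = "\<lambda>_. borel" and X = "\<lambda>i \<omega>. z \<omega> $ i"
          and Y = "\<lambda>i x. 0 + (u $ i / \<sigma>) * x"] indep_vars_subset[of _ _ UNIV I]) auto
  moreover have "distributed M lborel (\<lambda>\<omega>. 0 + (u $ i / \<sigma>) * z \<omega> $ i)
      (normal_density (0 + (u $ i / \<sigma>) * 0) (\<bar>u $ i / \<sigma>\<bar> * \<sigma>))" if "i \<in> I" for i
    using noise that \<open>0 < \<sigma>\<close> unfolding white_noise_def
    by (intro normal_density_affine) (auto simp: I_def)
  moreover have "I \<noteq> {}" using norm_u by auto
  ultimately have "distributed M lborel (\<lambda>\<omega>. \<Sum>i\<in>I. 0 + (u $ i / \<sigma>) * z \<omega> $ i)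
      (normal_density (\<Sum>i\<in>I. 0 + (u $ i / \<sigma>) * 0) (sqrt (\<Sum>i\<in>I. (\<bar>u $ i / \<sigma>\<bar> * \<sigma>)\<^sup>2)))"
    using \<open>0 < \<sigma>\<close> by (intro sum_indep_normal) (auto simp: I_def)
  moreover have "(\<Sum>i\<in>I. 0 + (u $ i / \<sigma>) * z \<omega> $ i) = (u \<bullet> z \<omega>) / \<sigma>" for \<omega>
    unfolding inner_vec_def sum_divide_distrib
    by (intro sum.mono_neutral_cong_left) (auto simp: I_def)
  moreover have "(\<Sum>i\<in>I. (\<bar>u $ i / \<sigma>\<bar> * \<sigma>)\<^sup>2) = 1"
    using \<open>0 < \<sigma>\<close> norm_u by (simp add: power_mult_distrib power_divide)
  ultimately show ?thesis by simp
qed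

end

section \<open>Measurability of events about minimisers\<close>

text \<open>Bounded sublevel sets replace compactness of \<open>D\<close>: a minimum over the part
  of \<open>D\<close> below the value at one of its points is a minimum over
  \<open>D\<close>.\<close>

lemma ex_minimum_closed:
  fixes f :: "'b::euclidean_space \<Rightarrow> real"
  assumes "closed D" "D \<noteq> {}" and f: "continuous_on UNIV f" "\<And>q. bounded {b. f b \<le> q}"
  shows "\<exists>b\<in>D. \<forall>b'\<in>D. f b \<le> f b'"
proof -
  obtain d where d: "d \<in> D" using assms(2) by auto
  have "closed {b. f b \<le> f d}"
    by (intro closed_Collect_le f continuous_on_const)
  then have "compact (D \<inter> {b. f b \<le> f d})"
    using f(2) assms(1) by (metis closed_Int_compact compact_eq_bounded_closed)
  then obtain b where b: "b \<in> D \<inter> {b. f b \<le> f d}" "\<forall>b'\<in>D \<inter> {b. f b \<le> f d}. f b \<le> f b'"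
    using continuous_attains_inf[of "D \<inter> {b. f b \<le> f d}" f] d continuous_on_subset[OF f(1)] by auto
  then have "f b \<le> f b'" if "b' \<in> D" for b'
    using that by (cases "f b' \<le> f d") auto
  then show ?thesis using b by auto
qed

text \<open>The error event quantifies over uncountably many candidate solutions, and \<^const>\<open>measure\<close> is
  \<open>0\<close> on non-measurable sets. Minimisers in \<open>C\<close> exist iff the constrained and the unconstrained
  minimum agree, which is a countable condition on sublevel sets; these are projections along
  compact sets.\<close>

lemma borel_ex_arg_min_closed:
  fixes f :: "'b::euclidean_space \<Rightarrow> real" and G :: "('b \<times> 'y::euclidean_space) set"
  assumes G: "closed G" and f: "continuous_on UNIV f" "\<And>q. bounded {b. f b \<le> q}"
    and C: "closed C"
  shows "{y. \<exists>b\<in>C. is_arg_min f (\<lambda>b. (b, y) \<in> G) b} \<in> sets borel"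
proof -
  define A where "A = (\<lambda>C q. {y. \<exists>b. b \<in> C \<inter> {b. f b \<le> q} \<and> (b, y) \<in> G})"
  have A_closed: "closed (A C q)" if "closed C" for C q
  proof -
    have "closed {b. f b \<le> q}"
      by (intro closed_Collect_le f continuous_on_const)
    then have "compact (C \<inter> {b. f b \<le> q})"
      using f(2) that by (metis closed_Int_compact compact_eq_bounded_closed)
    then show ?thesis unfolding A_def using G by (rule closed_compact_projection)
  qed
  have fiber: "closed {b. (b, y) \<in> G}" for y
    using closed_vimage[OF G, of "\<lambda>b. (b, y)"] by (simp add: vimage_def continuous_intros)
  \<comment> \<open>The union says that \<open>y\<close> has a feasible point at all; the
    intersection says that every rational level reached by a feasible point is reached by one in
    \<open>C\<close>.\<close>
  have "{y. \<exists>b\<in>C. is_arg_min f (\<lambda>b. (b, y) \<in> G) b}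
      = (\<Union>q\<in>\<rat>. A UNIV q) \<inter> (\<Inter>q\<in>\<rat>. - A UNIV q \<union> A C q)" (is "?L = ?R")
  proof (intro set_eqI iffI)
    fix y assume "y \<in> ?L"
    then obtain b where b: "b \<in> C" "(b, y) \<in> G" "\<And>b'. (b', y) \<in> G \<Longrightarrow> f b \<le> f b'"
      by (auto simp: is_arg_min_linorder)
    obtain q where "q \<in> \<rat>" "f b < q" using Rats_dense_in_real[of "f b" "f b + 1"] by auto
    then have "y \<in> A UNIV q" using b(2) by (auto simp: A_def intro!: exI[of _ b])
    moreover have "y \<in> A C r" if r: "y \<in> A UNIV r" for r
    proof -
      obtain b' where "f b' \<le> r" "(b', y) \<in> G" using r by (auto simp: A_def)
      then have "f b \<le> r" using b(3) order_trans by blast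
      then show ?thesis using b(1,2) by (auto simp: A_def)
    qed
    ultimately show "y \<in> ?R" using \<open>q \<in> \<rat>\<close> by auto
  next
    fix y assume R: "y \<in> ?R"
    define F where "F = {b. (b, y) \<in> G}"
    have F: "closed F" "b \<in> F \<longleftrightarrow> (b, y) \<in> G" for b
      using fiber[of y] by (auto simp: F_def)
    have "F \<noteq> {}" using R by (auto simp: A_def F)
    then obtain b0 where b0: "b0 \<in> F" "\<And>b'. b' \<in> F \<Longrightarrow> f b0 \<le> f b'"
      using ex_minimum_closed[OF F(1) _ f] by auto
    have above: "\<exists>b\<in>C \<inter> F. f b \<le> q" if "q \<in> \<rat>" "f b0 < q" for q
    proof -
      have "y \<in> A UNIV q" using b0(1) that by (auto simp: A_def F intro!: exI[of _ b0])
      then have "y \<in> A C q" using R that by auto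
      then show ?thesis by (auto simp: A_def F)
    qed
    obtain q where "q \<in> \<rat>" "f b0 < q" using Rats_dense_in_real[of "f b0" "f b0 + 1"] by auto
    then have "C \<inter> F \<noteq> {}" using above by blast
    then obtain b1 where b1: "b1 \<in> C \<inter> F" "\<And>b'. b' \<in> C \<inter> F \<Longrightarrow> f b1 \<le> f b'"
      using ex_minimum_closed[OF closed_Int[OF C F(1)] _ f] by auto
    \<comment> \<open>A gap between the constrained and unconstrained minima would contain a
      rational level reached by \<open>b0\<close> but by no feasible point of
      \<open>C\<close>.\<close>
    have "f b1 \<le> f b0"
    proof (rule ccontr)
      assume "\<not> f b1 \<le> f b0"
      then obtain q where "q \<in> \<rat>" "f b0 < q" "q < f b1"
        using Rats_dense_in_real[of "f b0" "f b1"] by auto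
      then show False using above b1(2) by fastforce
    qed
    then have "is_arg_min f (\<lambda>b. (b, y) \<in> G) b1"
      using b0(2) b1(1) by (auto simp: is_arg_min_linorder F intro: order_trans)
    then show "y \<in> ?L" using b1(1) by auto
  qed
  also have "\<dots> \<in> sets borel"
    using A_closed[OF closed_UNIV] A_closed[OF C]
    by (intro sets.Int sets.countable_UN'' sets.countable_INT'' sets.Un borel_comp borel_closed)
      (auto simp: countable_rat)
  finally show ?thesis .
qed

text \<open>The set where \<open>g\<close> exceeds \<open>K\<close> is open rather than closed, so
  it is exhausted by countably many closed sets where \<open>g\<close> exceeds \<open>K\<close> by a
  fixed margin.\<close>

lemma borel_ex_arg_min_greater:
  fixes f g :: "'b::euclidean_space \<Rightarrow> real" and G :: "('b \<times> 'y::euclidean_space) set"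
  assumes G: "closed G" and f: "continuous_on UNIV f" "\<And>q. bounded {b. f b \<le> q}"
    and g: "continuous_on UNIV g"
  shows "{y. \<exists>b. is_arg_min f (\<lambda>b. (b, y) \<in> G) b \<and> K < g b} \<in> sets borel"
proof -
  have "{y. \<exists>b. is_arg_min f (\<lambda>b. (b, y) \<in> G) b \<and> K < g b}
      = (\<Union>m. {y. \<exists>b\<in>{b. K + inverse (real (Suc m)) \<le> g b}. is_arg_min f (\<lambda>b. (b, y) \<in> G) b})"
  proof -
    have "K < x \<longleftrightarrow> (\<exists>m. K + inverse (real (Suc m)) \<le> x)" for x
    proof
      assume "K < x"
      then obtain m where "inverse (real (Suc m)) < x - K"
        using reals_Archimedean[of "x - K"] by auto
      then show "\<exists>m. K + inverse (real (Suc m)) \<le> x" by (intro exI[of _ m]) auto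
    next
      assume "\<exists>m. K + inverse (real (Suc m)) \<le> x"
      then obtain m where "K + inverse (real (Suc m)) \<le> x" ..
      moreover have "0 < inverse (real (Suc m))" by simp
      ultimately show "K < x" by linarith
    qed
    then show ?thesis by blast
  qed
  also have "\<dots> \<in> sets borel"
    by (intro sets.countable_UN image_subsetI borel_ex_arg_min_closed assms closed_Collect_le
        continuous_intros)
  finally show ?thesis .
qed

section \<open>The selector's error on the event of small noise correlations\<close>

lemma infnorm_le_iff_cart:
  fixes x :: "real ^ 'n"
  shows "infnorm x \<le> t \<longleftrightarrow> (\<forall>i. \<bar>x $ i\<bar> \<le> t)"
proof
  assume "infnorm x \<le> t"
  then show "\<forall>i. \<bar>x $ i\<bar> \<le> t" using component_le_infnorm_cart order_trans by blast
next
  assume "\<forall>i. \<bar>x $ i\<bar> \<le> t"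
  then show "infnorm x \<le> t" unfolding infnorm_cart by (intro cSup_least) auto
qed

lemma transpose_mult_component: "(transpose X *v u) $ j = u \<bullet> column j X"
  for X :: "real ^ 'p ^ 'n"
  by (simp add: matrix_vector_mult_def transpose_def column_def inner_vec_def mult.commute)

text \<open>The noise bound makes \<open>\<beta>\<close> feasible, so \<open>b\<close> has no larger
  l1 norm, which yields the cone condition for \<open>h\<close>. Feasibility of \<open>b\<close> and
  the noise bound together give the correlation bound with
  \<open>\<tau> = 2 * lam * \<sigma>\<close>.\<close>

lemma dantzig_selector_error_bound:
  fixes X :: "real ^ 'p ^ 'n" and b \<beta> :: "real ^ 'p"
  assumes S: "1 \<le> S" "3 * S \<le> CARD('p)" and unit: "\<And>j. norm (column j X) = 1"
    and const: "restricted_isometry_const X (2 * S) + restricted_orthogonality_const X S (2 * S) < 1"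
    and sparse: "sparse_vec S \<beta>"
    and noise: "\<And>j. \<bar>u \<bullet> column j X\<bar> \<le> lam * \<sigma>"
    and b: "dantzig_selector X (X *v \<beta> + u) lam \<sigma> b"
  shows "(norm (b - \<beta>))\<^sup>2 \<le>
    (dantzig_const (restricted_isometry_const X S) (restricted_orthogonality_const X S (2 * S)))\<^sup>2
      * lam\<^sup>2 * real S * \<sigma>\<^sup>2"
proof -
  define h where "h = b - \<beta>"
  define T where "T = {j. \<beta> $ j \<noteq> 0}"
  define \<delta> where "\<delta> = restricted_isometry_const X S"
  define \<theta> where "\<theta> = restricted_orthogonality_const X S (2 * S)"
  have "\<delta> \<le> restricted_isometry_const X (2 * S)"
    unfolding \<delta>_def using S by (intro restricted_isometry_const_mono unit) auto
  then have \<delta>\<theta>: "\<delta> + \<theta> < 1" using const by (simp add: \<theta>_def)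
  have two: "2 \<le> CARD('p)" "1 \<le> 2 * S" using S by auto
  have feasible_\<beta>: "infnorm (transpose X *v (X *v \<beta> + u - X *v \<beta>)) \<le> lam * \<sigma>"
    using noise by (simp only: infnorm_le_iff_cart transpose_mult_component add_diff_cancel_left')
      blast
  have feasible_b: "infnorm (transpose X *v (X *v \<beta> + u - X *v b)) \<le> lam * \<sigma>"
    and l1: "l1_norm b \<le> l1_norm \<beta>"
    using b feasible_\<beta> unfolding dantzig_selector_def is_arg_min_linorder by auto
  have split: "(\<Sum>j\<in>UNIV. f j) = (\<Sum>j\<in>T. f j) + (\<Sum>j\<in>-T. f j)" for f :: "'p \<Rightarrow> real"
    using sum.subset_diff[of T UNIV f] by (simp add: Compl_eq_Diff_UNIV)
  have "(\<Sum>j\<in>T. \<bar>\<beta> $ j\<bar> - \<bar>h $ j\<bar>) \<le> (\<Sum>j\<in>T. \<bar>b $ j\<bar>)"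
    by (intro sum_mono) (simp add: h_def)
  moreover have "(\<Sum>j\<in>-T. \<bar>\<beta> $ j\<bar>) = 0" "(\<Sum>j\<in>-T. \<bar>b $ j\<bar>) = (\<Sum>j\<in>-T. \<bar>h $ j\<bar>)"
    by (auto simp: T_def h_def)
  ultimately have cone: "(\<Sum>j\<in>-T. \<bar>h $ j\<bar>) \<le> (\<Sum>j\<in>T. \<bar>h $ j\<bar>)"
    using l1 by (simp add: l1_norm_def split sum_subtractf)
  have corr: "\<bar>(X *v h) \<bullet> column j X\<bar> \<le> 2 * lam * \<sigma>" for j
  proof -
    have "X *v h = u - (X *v \<beta> + u - X *v b)"
      by (simp add: h_def matrix_vector_mult_diff_distrib)
    then have "(X *v h) \<bullet> column j X = u \<bullet> column j X - (X *v \<beta> + u - X *v b) \<bullet> column j X"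
      by (simp only: inner_diff_left)
    moreover have "\<bar>(X *v \<beta> + u - X *v b) \<bullet> column j X\<bar> \<le> lam * \<sigma>"
      using feasible_b by (simp only: infnorm_le_iff_cart transpose_mult_component)
    ultimately show ?thesis using noise[of j] by linarith
  qed
  have RIP: "(1 - \<delta>) * (L2_set c A)\<^sup>2 \<le> (norm (submatrix_mult X A c))\<^sup>2"
    if "card A \<le> S" for A c
    using restricted_isometry_const_Least(1)[OF unit S(1)] that unfolding \<delta>_def by blast
  \<comment> \<open>Sets of size at most \<open>S\<close> are in particular of size at most
    \<open>2 * S\<close>, so \<theta>_{S,2S} serves here.\<close>
  have ROC: "\<bar>submatrix_mult X A c \<bullet> submatrix_mult X A' c'\<bar> \<le> \<theta> * L2_set c A * L2_set c' A'"
    if "A \<inter> A' = {}" "card A \<le> S" "card A' \<le> S" for A A' c c'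
    unfolding \<theta>_def
    by (rule restricted_orthogonality_const_nonneg_bound(2)[OF unit S(1) two(2,1)]) (use that in auto)
  have "0 \<le> \<theta>"
    unfolding \<theta>_def by (rule restricted_orthogonality_const_nonneg_bound(1)[OF unit S(1) two(2,1)])
  moreover have "card T \<le> S" using sparse by (simp add: T_def sparse_vec_def)
  moreover have "2 * S \<le> CARD('p)" using S by simp
  ultimately have "(norm h)\<^sup>2 \<le> 2 * real S * (2 * lam * \<sigma> / (1 - \<delta> - \<theta>))\<^sup>2"
    using norm_sq_le_of_cone[OF S(1) _ RIP ROC _ \<delta>\<theta> _ cone corr] by blast
  also have "\<dots> = 8 * ((lam * \<sigma> / (1 - \<delta> - \<theta>))\<^sup>2 * real S)"
    by (simp add: power_mult_distrib power_divide)
  \<comment> \<open>The argument gives the factor 8; it is relaxed to 16, the square of the 4 in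
    \<open>dantzig_const\<close>.\<close>
  also have "\<dots> \<le> 16 * ((lam * \<sigma> / (1 - \<delta> - \<theta>))\<^sup>2 * real S)"
    by (intro mult_right_mono) auto
  also have "\<dots> = (dantzig_const \<delta> \<theta>)\<^sup>2 * lam\<^sup>2 * real S * \<sigma>\<^sup>2"
    by (simp add: dantzig_const_def power_mult_distrib power_divide)
  finally show ?thesis by (simp add: h_def \<delta>_def \<theta>_def)
qed

section \<open>From the deterministic bound to the probability\<close>

lemma continuous_on_l1_norm: "continuous_on UNIV l1_norm"
  unfolding l1_norm_def[abs_def] by (intro continuous_intros)

lemma bounded_l1_norm_le: "bounded {b :: real ^ 'p. l1_norm b \<le> q}"
proof (rule boundedI)
  fix b :: "real ^ 'p" assume "b \<in> {b. l1_norm b \<le> q}"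
  then show "norm b \<le> q" using norm_le_l1_cart[of b] by (simp add: l1_norm_def)
qed

text \<open>The constraint is jointly closed in \<open>b\<close> and \<open>y\<close>, so the
  complementary event, that some minimiser has a large error, is Borel.\<close>

lemma borel_dantzig_selector_error:
  fixes X :: "real ^ 'p ^ 'n" and \<beta> :: "real ^ 'p"
  shows "{y. \<forall>b. dantzig_selector X y lam \<sigma> b \<longrightarrow> (norm (b - \<beta>))\<^sup>2 \<le> K} \<in> sets borel"
proof -
  let ?G = "{(b, y). infnorm (transpose X *v (y - X *v b)) \<le> lam * \<sigma>}"
  have "closed ?G"
    unfolding case_prod_beta
    by (intro closed_Collect_le continuous_intros matrix_vector_mult_linear_continuous_on
        continuous_on_compose2[OF matrix_vector_mult_linear_continuous_on]) auto
  then have "{y. \<exists>b. is_arg_min l1_norm (\<lambda>b. (b, y) \<in> ?G) b \<and> K < (norm (b - \<beta>))\<^sup>2} \<in> sets borel"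
    by (rule borel_ex_arg_min_greater)
      (intro continuous_on_l1_norm bounded_l1_norm_le continuous_intros)+
  then have "- {y. \<exists>b. is_arg_min l1_norm (\<lambda>b. (b, y) \<in> ?G) b \<and> K < (norm (b - \<beta>))\<^sup>2} \<in> sets borel"
    by (rule borel_comp)
  also have "- {y. \<exists>b. is_arg_min l1_norm (\<lambda>b. (b, y) \<in> ?G) b \<and> K < (norm (b - \<beta>))\<^sup>2}
      = {y. \<forall>b. dantzig_selector X y lam \<sigma> b \<longrightarrow> (norm (b - \<beta>))\<^sup>2 \<le> K}"
    by (auto simp: dantzig_selector_def not_less)
  finally show ?thesis .
qed

lemma dantzig_selector_error_prob:
  fixes X :: "real ^ 'p ^ 'n" and \<beta> :: "real ^ 'p" and z :: "'a \<Rightarrow> real ^ 'n"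
  assumes S: "1 \<le> S" "3 * S \<le> CARD('p)" and \<sigma>: "0 < \<sigma>"
    and unit: "\<And>j. norm (column j X) = 1"
    and const: "restricted_isometry_const X (2 * S) + restricted_orthogonality_const X S (2 * S) < 1"
    and sparse: "sparse_vec S \<beta>"
    and "prob_space M" and noise: "white_noise M \<sigma> z"
    and a: "0 \<le> a" and lam: "lam = sqrt (2 * (1 + a) * ln (real CARD('p)))"
  shows "1 - 1 / (sqrt (pi * ln (real CARD('p))) * real CARD('p) powr a)
    < measure M {\<omega> \<in> space M. \<forall>b. dantzig_selector X (X *v \<beta> + z \<omega>) lam \<sigma> b \<longrightarrow>
        (norm (b - \<beta>))\<^sup>2 \<le>
          (dantzig_const (restricted_isometry_const X S)
             (restricted_orthogonality_const X S (2 * S)))\<^sup>2 * lam\<^sup>2 * real S * \<sigma>\<^sup>2}"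
    (is "_ < measure M ?E")
proof -
  interpret prob_space M by fact
  define p where "p = real CARD('p)"
  have p: "1 < p" using S by (simp add: p_def)
  then have lnp: "0 < ln p" by simp
  have lam_sq: "lam\<^sup>2 = 2 * (1 + a) * ln p" using lnp a by (simp add: lam p_def)
  have lam_pos: "0 < lam" using lnp a by (simp add: lam p_def)
  let ?Y = "\<lambda>j \<omega>. (column j X \<bullet> z \<omega>) / \<sigma>"
  have [measurable]: "z \<in> borel_measurable M"
  proof (rule borel_measurable_euclidean_space[THEN iffD2], intro ballI)
    fix i :: "real ^ 'n" assume "i \<in> Basis"
    then obtain k where i: "i = axis k 1" by (auto simp: Basis_vec_def)
    have "distributed M lborel (\<lambda>\<omega>. z \<omega> $ k) (normal_density 0 \<sigma>)"
      using noise by (simp add: white_noise_def)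
    from distributed_measurable[OF this]
    show "(\<lambda>\<omega>. z \<omega> \<bullet> i) \<in> borel_measurable M" by (simp add: i inner_axis)
  qed
  let ?B = "{y. \<forall>b. dantzig_selector X y lam \<sigma> b \<longrightarrow> (norm (b - \<beta>))\<^sup>2 \<le>
          (dantzig_const (restricted_isometry_const X S)
             (restricted_orthogonality_const X S (2 * S)))\<^sup>2 * lam\<^sup>2 * real S * \<sigma>\<^sup>2}"
  have "(\<lambda>\<omega>. X *v \<beta> + z \<omega>) -` ?B \<inter> space M \<in> sets M"
    by (rule measurable_sets[OF _ borel_dantzig_selector_error]) measurable
  also have "(\<lambda>\<omega>. X *v \<beta> + z \<omega>) -` ?B \<inter> space M = ?E" by blast
  \<comment> \<open>Monotonicity of the measure towards \<open>?E\<close> depends on this.\<close>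
  finally have E: "?E \<in> sets M" .
  have "{\<omega> \<in> space M. \<forall>j. \<bar>?Y j \<omega>\<bar> \<le> lam} \<subseteq> ?E"
  proof (intro subsetI CollectI conjI allI impI)
    fix \<omega> b
    assume \<omega>: "\<omega> \<in> {\<omega> \<in> space M. \<forall>j. \<bar>?Y j \<omega>\<bar> \<le> lam}"
      and b: "dantzig_selector X (X *v \<beta> + z \<omega>) lam \<sigma> b"
    have "\<bar>z \<omega> \<bullet> column j X\<bar> \<le> lam * \<sigma>" for j
    proof -
      have "\<bar>?Y j \<omega>\<bar> \<le> lam" using \<omega> by blast
      then show ?thesis using \<sigma> by (simp add: abs_divide pos_divide_le_eq inner_commute)
    qed
    from dantzig_selector_error_bound[OF S unit const sparse this b]
    show "(norm (b - \<beta>))\<^sup>2 \<le>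
          (dantzig_const (restricted_isometry_const X S)
             (restricted_orthogonality_const X S (2 * S)))\<^sup>2 * lam\<^sup>2 * real S * \<sigma>\<^sup>2" .
  qed auto
  then have "prob {\<omega> \<in> space M. \<forall>j. \<bar>?Y j \<omega>\<bar> \<le> lam} \<le> prob ?E"
    using E by (rule finite_measure_mono)
  moreover have "1 - 2 * p * std_normal_density lam / lam < prob {\<omega> \<in> space M. \<forall>j. \<bar>?Y j \<omega>\<bar> \<le> lam}"
    unfolding p_def
    by (intro prob_all_abs_std_normal_le white_noise_inner_distributed noise \<sigma> unit lam_pos)
  \<comment> \<open>The choice of \<open>lam\<close> makes \<open>exp (- lam\<^sup>2 / 2)\<close>
    equal to \<open>p powr (- (1 + a))\<close>, which absorbs the \<open>p\<close> of the union
    bound. The remaining \<open>lam\<close> in the denominator is at least its value at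
    \<open>a = 0\<close>.\<close>
  moreover have "2 * p * std_normal_density lam / lam \<le> 1 / (sqrt (pi * ln p) * p powr a)"
  proof -
    have "- lam\<^sup>2 / 2 = - (1 + a) * ln p" by (simp add: lam_sq field_simps)
    then have "exp (- lam\<^sup>2 / 2) = p powr (- (1 + a))"
      using p by (simp only: powr_def) simp
    also have "\<dots> = 1 / (p * p powr a)"
      using p by (simp only: powr_minus_divide powr_add) simp
    finally have "2 * p * std_normal_density lam / lam = 2 / (sqrt (2 * pi) * lam * p powr a)"
      using p by (simp add: std_normal_density_def)
    also have "\<dots> \<le> 2 / ((2 * sqrt (pi * ln p)) * p powr a)"
    proof -
      have "2 * sqrt (pi * ln p) = sqrt (2 * pi * (2 * 1 * ln p))"
        by (simp add: real_sqrt_mult)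
      also have "\<dots> \<le> sqrt (2 * pi * (2 * (1 + a) * ln p))"
        using a lnp by (intro real_sqrt_le_mono mult_left_mono mult_right_mono) auto
      also have "\<dots> = sqrt (2 * pi) * lam"
        by (simp add: lam p_def real_sqrt_mult)
      finally show ?thesis
        using p lnp lam_pos by (intro divide_left_mono mult_right_mono mult_pos_pos) auto
    qed
    finally show ?thesis by simp
  qed
  ultimately show ?thesis by (simp add: p_def)
qed

text \<open>The approximation of C_1 by 4 is read as continuity of \<open>4 / (1 - x)\<close> at 0,
  with \<open>x = \<delta> + \<theta>\<close>.\<close>

lemma dantzig_const_near_4:
  assumes "0 < \<epsilon>"
  shows "\<exists>\<eta>>0. \<forall>\<delta> \<theta>. \<bar>\<delta> + \<theta>\<bar> < \<eta> \<longrightarrow> \<bar>dantzig_const \<delta> \<theta> - 4\<bar> < \<epsilon>"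
proof -
  have "isCont (\<lambda>x::real. 4 / (1 - x)) 0" by (intro continuous_intros) auto
  then obtain \<eta> where "0 < \<eta>" "\<And>x. \<bar>x\<bar> < \<eta> \<Longrightarrow> \<bar>4 / (1 - x) - 4\<bar> < \<epsilon>"
    using assms by (auto simp: continuous_at_eps_delta dist_real_def)
  then show ?thesis
    by (intro exI[of _ \<eta>]) (auto simp: dantzig_const_def diff_diff_add)
qed

theorem theorem1p1:
  fixes X :: "real ^ 'p ^ 'n" and \<beta> :: "real ^ 'p" and S :: nat and \<sigma> :: real
    and M :: "'a measure" and z :: "'a \<Rightarrow> real ^ 'n"
  assumes "CARD('n) \<ge> 1" and "CARD('p) \<ge> 2" and "S \<ge> 1" and "3 * S \<le> CARD('p)"
    and "\<sigma> > 0"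
    and "\<And>j. norm (column j X) = 1"
    and "restricted_isometry_const X (2 * S) + restricted_orthogonality_const X S (2 * S) < 1"
    and "sparse_vec S \<beta>"
    and "prob_space M" and "white_noise M \<sigma> z"
  shows "measure M {\<omega> \<in> space M. \<forall>b.
            dantzig_selector X (X *v \<beta> + z \<omega>) (sqrt (2 * ln (real CARD('p)))) \<sigma> b \<longrightarrow>
            (norm (b - \<beta>))\<^sup>2 \<le>
              (dantzig_const (restricted_isometry_const X S)
                 (restricted_orthogonality_const X S (2 * S)))\<^sup>2
              * (2 * ln (real CARD('p))) * real S * \<sigma>\<^sup>2}
          > 1 - 1 / sqrt (pi * ln (real CARD('p))) \<and>
        (\<forall>\<epsilon>>0. \<exists>\<eta>>0. \<forall>\<delta> \<theta>. \<bar>\<delta> + \<theta>\<bar> < \<eta> \<longrightarrow> \<bar>dantzig_const \<delta> \<theta> - 4\<bar> < \<epsilon>) \<and>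
        (\<forall>a lam. a \<ge> 0 \<longrightarrow> lam = sqrt (2 * (1 + a) * ln (real CARD('p))) \<longrightarrow>
          measure M {\<omega> \<in> space M. \<forall>b.
            dantzig_selector X (X *v \<beta> + z \<omega>) lam \<sigma> b \<longrightarrow>
            (norm (b - \<beta>))\<^sup>2 \<le>
              (dantzig_const (restricted_isometry_const X S)
                 (restricted_orthogonality_const X S (2 * S)))\<^sup>2
              * lam\<^sup>2 * real S * \<sigma>\<^sup>2}
          > 1 - 1 / (sqrt (pi * ln (real CARD('p))) * real CARD('p) powr a))"
proof (intro conjI allI impI)
  note main = dantzig_selector_error_prob[OF assms(3-10)]
  have "(sqrt (2 * ln (real CARD('p))))\<^sup>2 = 2 * ln (real CARD('p))"
    using assms(2) by simp
  then show "1 - 1 / sqrt (pi * ln (real CARD('p)))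
      < measure M {\<omega> \<in> space M. \<forall>b.
            dantzig_selector X (X *v \<beta> + z \<omega>) (sqrt (2 * ln (real CARD('p)))) \<sigma> b \<longrightarrow>
            (norm (b - \<beta>))\<^sup>2 \<le>
              (dantzig_const (restricted_isometry_const X S)
                 (restricted_orthogonality_const X S (2 * S)))\<^sup>2
              * (2 * ln (real CARD('p))) * real S * \<sigma>\<^sup>2}"
    \<comment> \<open>At \<open>a = 0\<close> the factor \<open>real CARD('p) powr a\<close> is
      1.\<close>
    using main[of 0 "sqrt (2 * ln (real CARD('p)))"] by simp
qed (use dantzig_const_near_4 dantzig_selector_error_prob[OF assms(3-10)] in blast)+

end
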